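(* Let $X=\{X_j,j\ge 1\}$ be independent square integrable random variables with values in the lattice $\mathcal L(v_0,D)$, with $\sigma_n^2=\mathrm{Var}(S_n)\to\infty$ and $\vartheta_{X_j}>0$ for every $j\ge1$. Let $0<\vartheta_j\le\vartheta_{X_j}$ ($j\ge 1$) be such that $\nu_n=\sum_{j=1}^n\vartheta_j\uparrow\infty$. Let $\kappa_j\in\mathcal L(jv_0,D)$, $j=1,2,\ldots$, be such that (1) $\dfrac{\kappa_j-a_j}{\sigma_j}=\mathcal O(1)$ as $j\to\infty$; (2) $(\sigma_j^2-\sigma_i^2)^{1/2}\,\mathbb P\{S_j-S_i=\kappa_j-\kappa_i\}=\mathcal O(1)$, uniformly over all $j\ge i\ge 0$. Then there exists a constant $C$ such that for all integers $1\le m<n$, $$\sigma_n\sigma_m\Big|\mathbb P\{S_n=\kappa_n,S_m=\kappa_m\}-\mathbb P\{S_n=\kappa_n\}\mathbb P\{S_m=\kappa_m\}\Big|$$ $$\le \frac{C}{D^2}\,\max\Big(\frac{\sigma_n}{\sqrt{\nu_n}},\frac{\sigma_m}{\sqrt{\nu_m}}\Big)^3\bigg\{\nu_n^{1/2}\Big(\prod_{j=m+1}^n\vartheta_j+\frac{1}{(\nu_n-\nu_m)^{3/2}}\Big)+\frac{1}{\sqrt{\nu_n/\nu_m}-1}\bigg\}.$$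
   Context: $v_0\in\mathbb R$ and $D>0$ are fixed reals, $v_k=v_0+Dk$ for $k\in\mathbb Z$, and $\mathcal L(v_0,D)=\{v_k:k\in\mathbb Z\}$; likewise $\mathcal L(jv_0,D)=\{jv_0+Dk:k\in\mathbb Z\}$. $S_n=X_1+\cdots+X_n$, $a_n=\mathbb E S_n$, $\sigma_n^2=\mathrm{Var}(S_n)$. Conventions for index $0$: $S_0=0$, $\sigma_0=0$, $\kappa_0=0$. For a random variable $Y$ with $\mathbb P\{Y\in\mathcal L(v_0,D)\}=1$, $\vartheta_Y=\sum_{k\in\mathbb Z}\min\big(\mathbb P\{Y=v_k\},\mathbb P\{Y=v_{k+1}\}\big)$ (one always has $0\le\vartheta_Y<1$). The constant $C$ does not depend on $m,n$. *)

theory Defs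
  imports "HOL-Probability.Probability" "HOL-Library.Landau_Symbols"
begin

definition lattice_pt :: "real \<Rightarrow> real \<Rightarrow> int \<Rightarrow> real" where
  "lattice_pt v D k = v + D * of_int k"

definition lattice_set :: "real \<Rightarrow> real \<Rightarrow> real set" where
  "lattice_set v D = range (lattice_pt v D)"

text \<open>The sum over all integers below is unconditional. Its terms are dominated by the
  probabilities of disjoint events, so it always converges when \<open>D > 0\<close>
  and \<open>Y\<close> is a random variable.\<close>

definition vartheta :: "'a measure \<Rightarrow> real \<Rightarrow> real \<Rightarrow> ('a \<Rightarrow> real) \<Rightarrow> real" where
  "vartheta M v D Y =
     (\<Sum>\<^sub>\<infinity>k::int. min \<P>(\<omega> in M. Y \<omega> = lattice_pt v D k) \<P>(\<omega> in M. Y \<omega> = lattice_pt v D (k + 1)))"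

text \<open>Sequences are indexed from \<open>1\<close>; the value at index \<open>0\<close> is ignored, and sums up to \<open>0\<close> are empty.\<close>

definition S :: "(nat \<Rightarrow> 'a \<Rightarrow> real) \<Rightarrow> nat \<Rightarrow> 'a \<Rightarrow> real" where
  "S X n \<omega> = (\<Sum>j=1..n. X j \<omega>)"

definition mean_S :: "'a measure \<Rightarrow> (nat \<Rightarrow> 'a \<Rightarrow> real) \<Rightarrow> nat \<Rightarrow> real" where
  "mean_S M X n = prob_space.expectation M (S X n)"

definition sd_S :: "'a measure \<Rightarrow> (nat \<Rightarrow> 'a \<Rightarrow> real) \<Rightarrow> nat \<Rightarrow> real" where
  "sd_S M X n = sqrt (prob_space.variance M (S X n))"

definition nu :: "(nat \<Rightarrow> real) \<Rightarrow> nat \<Rightarrow> real" where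
  "nu \<theta> n = (\<Sum>j=1..n. \<theta> j)"

end

(* Write T = S_n - S_m, which is independent of S_m. Since sigma_m P(S_m = kappa_m) is bounded, the
   correlation is controlled by P(T = kappa_n - kappa_m) - P(S_n = kappa_n). Fourier inversion on
   the lattice expresses this difference as the integral of phi_Z (1 - phi_W) over [-pi, pi], where
   W = (S_m - kappa_m) / D and Z = (T - kappa_n + kappa_m) / D. Here |1 - phi_W(s)| <= |s| E|W| with
   E|W| = O(sigma_m) by the first condition, and the overlap of neighbouring lattice points gives
   |phi_Z(s)| <= exp(-(nu_n - nu_m) s^2 / 16); so the difference is O(sigma_m / (nu_n - nu_m)).
   As sigma_n^2 >= D^2 nu_n / 4, this is already dominated by the last term of the bound. *)
theory Submission
  imports Defs
begin

section \<open>Overlap of neighbouring lattice points\<close>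

text \<open>Each weight min(p_k, p_(k+1)), multiplied by \<delta>, is at most p_k g(x_k) + p_(k+1)
  g(x_(k+1)). Summing over k counts every atom at most twice, hence the factor 2; mass elsewhere
  only increases the expectation of the nonnegative \<open>g\<close>. Used with a squared deviation
  and with 1 - cos.\<close>

lemma (in prob_space) vartheta_le_expectation:
  fixes g :: "real \<Rightarrow> real"
  assumes D: "D > 0" and Y[measurable]: "Y \<in> borel_measurable M"
    and int: "integrable M (\<lambda>\<omega>. g (Y \<omega>))"
    and g: "\<And>y. 0 \<le> g y" and \<delta>: "0 \<le> \<delta>"
    and pair: "\<And>k. \<delta> \<le> g (lattice_pt v D k) + g (lattice_pt v D (k + 1))"
  shows "\<delta> * vartheta M v D Y \<le> 2 * expectation (\<lambda>\<omega>. g (Y \<omega>))"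
proof -
  define E where "E = expectation (\<lambda>\<omega>. g (Y \<omega>))"
  define x where "x = lattice_pt v D"
  define p where "p k = prob {\<omega> \<in> space M. Y \<omega> = x k}" for k
  have inj: "x i = x j \<longleftrightarrow> i = j" for i j
    using D by (simp add: x_def lattice_pt_def)
  have E0: "0 \<le> E"
    unfolding E_def by (simp add: g)
  \<comment> \<open>The lattice points are distinct, so at each \<omega> at most one indicator
    survives and the sum is at most \<open>g (Y \<omega>)\<close>.\<close>
  have part: "(\<Sum>k\<in>F. p k * g (x k)) \<le> E" if F: "finite F" for F
  proof -
    have "(\<Sum>k\<in>F. p k * g (x k))
        = expectation (\<lambda>\<omega>. \<Sum>k\<in>F. indicat_real {\<omega> \<in> space M. Y \<omega> = x k} \<omega> * g (x k))"
      by (subst Bochner_Integration.integral_sum) (auto simp: p_def less_top[symmetric])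
    also have "\<dots> \<le> E"
      unfolding E_def
    proof (intro integral_mono int)
      show "(\<Sum>k\<in>F. indicat_real {\<omega> \<in> space M. Y \<omega> = x k} \<omega> * g (x k)) \<le> g (Y \<omega>)"
        if "\<omega> \<in> space M" for \<omega>
      proof (cases "\<exists>i\<in>F. Y \<omega> = x i")
        case True
        then obtain i where i: "i \<in> F" "Y \<omega> = x i" by auto
        have "(\<Sum>k\<in>F. indicat_real {\<omega> \<in> space M. Y \<omega> = x k} \<omega> * g (x k))
            = (\<Sum>k\<in>F. if k = i then g (x i) else 0)"
          using i that by (intro sum.cong) (auto simp: inj indicator_def)
        then show ?thesis using i F by simp
      next
        case False
        then show ?thesis using g by (auto intro!: order_trans[OF sum_nonpos])
      qed
    qed (auto simp: less_top[symmetric])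
    finally show ?thesis .
  qed
  define m where "m k = min (p k) (p (k + 1))" for k
  have p0: "0 \<le> p k" for k by (simp add: p_def)
  have fin: "\<delta> * sum m F \<le> 2 * E" if F: "finite F" for F
  proof -
    have "\<delta> * sum m F \<le> (\<Sum>k\<in>F. p k * g (x k) + p (k + 1) * g (x (k + 1)))"
      unfolding sum_distrib_left
    proof (intro sum_mono)
      fix k
      have "\<delta> * m k \<le> (g (x k) + g (x (k + 1))) * m k"
        using pair p0 by (intro mult_right_mono) (auto simp: m_def x_def)
      also have "\<dots> = m k * g (x k) + m k * g (x (k + 1))"
        by (simp add: algebra_simps)
      also have "\<dots> \<le> p k * g (x k) + p (k + 1) * g (x (k + 1))"
        by (intro add_mono mult_right_mono g) (auto simp: m_def)
      finally show "\<delta> * m k \<le> p k * g (x k) + p (k + 1) * g (x (k + 1))" .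
    qed
    \<comment> \<open>Reindexing by k + 1 makes both halves instances of
      \<open>part\<close>.\<close>
    also have "\<dots> = (\<Sum>k\<in>F. p k * g (x k)) + (\<Sum>k\<in>(\<lambda>k. k + 1) ` F. p k * g (x k))"
      by (simp add: sum.distrib sum.reindex)
    also have "\<dots> \<le> 2 * E"
      using part[OF F] part[of "(\<lambda>k. k + 1) ` F"] F by simp
    finally show ?thesis .
  qed
  have v: "vartheta M v D Y = infsum m UNIV"
    unfolding vartheta_def m_def[abs_def] p_def x_def ..
  \<comment> \<open>Without summability \<open>infsum\<close> has the default value 0, so the claim
    reduces to \<open>E0\<close>, as it does for \<delta> = 0. Otherwise the bound on finite sums
    passes to the infinite sum.\<close>
  show ?thesis
  proof (cases "\<delta> > 0 \<and> m summable_on UNIV")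
    case True
    then have "infsum m UNIV \<le> 2 * E / \<delta>"
      using fin by (intro infsum_le_finite_sums) (auto simp: field_simps)
    then show ?thesis using True by (simp add: v E_def field_simps)
  next
    case False
    then have "\<delta> * infsum m UNIV = 0"
      using \<delta> by (auto simp: infsum_not_exists)
    then show ?thesis using E0 unfolding v E_def[symmetric] by linarith
  qed
qed

text \<open>Two points at distance D have squared deviations from any centre adding up to at least
  D^2/2, with equality when the centre is their midpoint.\<close>

lemma (in prob_space) variance_ge_vartheta:
  assumes D: "D > 0" and Y[measurable]: "Y \<in> borel_measurable M"
    and sq: "integrable M (\<lambda>\<omega>. (Y \<omega>)\<^sup>2)"
  shows "D\<^sup>2 / 4 * vartheta M v D Y \<le> variance Y"
proof -
  have "integrable M Y"
    using square_integrable_imp_integrable[OF Y sq] .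
  then have "integrable M (\<lambda>\<omega>. (Y \<omega> - expectation Y)\<^sup>2)"
    using sq by (simp add: power2_diff)
  moreover have "D\<^sup>2 / 2 \<le> (lattice_pt v D k - expectation Y)\<^sup>2 + (lattice_pt v D (k + 1) - expectation Y)\<^sup>2"
    for k
  proof -
    define a where "a = lattice_pt v D k - expectation Y"
    have "lattice_pt v D (k + 1) - expectation Y = a + D"
      by (simp add: a_def lattice_pt_def algebra_simps)
    moreover have "a\<^sup>2 + (a + D)\<^sup>2 - D\<^sup>2 / 2 = 2 * (a + D / 2)\<^sup>2"
      by (simp add: power2_eq_square field_simps)
    moreover have "0 \<le> (a + D / 2)\<^sup>2" by simp
    ultimately show ?thesis
      unfolding a_def[symmetric] by (metis diff_ge_0_iff_ge mult_2 add_nonneg_nonneg)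
  qed
  ultimately have "D\<^sup>2 / 2 * vartheta M v D Y \<le> 2 * variance Y"
    using D by (intro vartheta_le_expectation[where g = "\<lambda>y. (y - expectation Y)\<^sup>2"]) auto
  then show ?thesis by simp
qed

text \<open>With y = |s|/4 the left side is y^2 and the right side is 2 sin(y)^2. As y \<le> 1, the
  cubic Taylor remainder gives sin y \<ge> 5y/6, and 2 * 25/36 exceeds 1.\<close>

lemma cos_half_le:
  fixes s :: real
  assumes "\<bar>s\<bar> \<le> pi"
  shows "s\<^sup>2 / 16 \<le> 1 - cos (s / 2)"
proof -
  define y where "y = \<bar>s\<bar> / 4"
  have y: "0 \<le> y" "y \<le> 1"
    using assms pi_less_4 by (auto simp: y_def)
  have "\<bar>sin y - y\<bar> \<le> inverse (fact 3) * \<bar>y\<bar> ^ 3"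
    using Maclaurin_sin_bound[of y 3] by (simp add: sin_coeff_def eval_nat_numeral)
  moreover have "y ^ 3 \<le> y"
    using power_decreasing[of 1 3 y] y by simp
  ultimately have "5 / 6 * y \<le> sin y"
    using y by (simp add: fact_numeral abs_if split: if_splits)
  then have "(5 / 6 * y)\<^sup>2 \<le> (sin y)\<^sup>2"
    using y by (intro power_mono) auto
  moreover have "1 - cos (s / 2) = 2 * (sin y)\<^sup>2"
    using cos_double_sin[of y] by (cases "0 \<le> s") (auto simp: y_def)
  moreover have "y\<^sup>2 = s\<^sup>2 / 16"
    by (simp add: y_def power_divide)
  moreover have "(5 / 6 * y)\<^sup>2 = 25 / 36 * y\<^sup>2"
    by (simp add: power2_eq_square)
  ultimately show ?thesis
    using zero_le_power2[of "sin y"] by linarith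
qed

text \<open>Rotating the characteristic function onto the positive axis turns
  \<open>1 - |\<phi>|\<close> into the expectation of \<open>1 - cos (\<dots>)\<close>, which two neighbouring
  lattice points cannot both make small.\<close>

lemma (in prob_space) char_le_vartheta:
  assumes D: "D > 0" and Y[measurable]: "Y \<in> borel_measurable M"
    and \<theta>: "\<theta> \<le> vartheta M v D Y" and s: "\<bar>s\<bar> \<le> pi"
  shows "cmod (char (distr M borel Y) (s / D)) \<le> exp (- (\<theta> * s\<^sup>2 / 16))"
proof -
  define z where "z = char (distr M borel Y) (s / D)"
  define \<alpha> where "\<alpha> = Arg z"
  define g where "g y = 1 - cos (s / D * y - \<alpha>)" for y
  have cos_int: "integrable M (\<lambda>\<omega>. cos (s / D * Y \<omega> - \<alpha>))"
    by (rule integrable_const_bound[where B = 1]) auto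
  have iexp_int: "integrable M (\<lambda>\<omega>. iexp (s / D * Y \<omega>))"
    by (rule integrable_iexp) auto
  have "complex_of_real (cmod z) = exp (- (\<i> * \<alpha>)) * z"
    by (metis (no_types) \<alpha>_def exp_minus_inverse mult.assoc mult.commute
        mult.left_neutral rcis_cmod_Arg rcis_def cis_conv_exp)
  also have "\<dots> = exp (- (\<i> * \<alpha>)) * expectation (\<lambda>\<omega>. iexp (s / D * Y \<omega>))"
    by (simp add: z_def char_def integral_distr)
  also have "\<dots> = expectation (\<lambda>\<omega>. iexp (s / D * Y \<omega> - \<alpha>))"
    using iexp_int by (subst integral_mult_right_zero[symmetric])
      (auto intro!: Bochner_Integration.integral_cong simp: exp_add[symmetric] algebra_simps)
  finally have "Re (complex_of_real (cmod z)) = Re (expectation (\<lambda>\<omega>. iexp (s / D * Y \<omega> - \<alpha>)))"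
    by (rule arg_cong)
  then have "cmod z = Re (expectation (\<lambda>\<omega>. iexp (s / D * Y \<omega> - \<alpha>)))"
    by simp
  also have "\<dots> = expectation (\<lambda>\<omega>. Re (iexp (s / D * Y \<omega> - \<alpha>)))"
    by (rule integral_Re[symmetric], rule integrable_iexp) auto
  also have "\<dots> = expectation (\<lambda>\<omega>. cos (s / D * Y \<omega> - \<alpha>))"
    by (simp add: Re_exp)
  finally have cz: "expectation (\<lambda>\<omega>. g (Y \<omega>)) = 1 - cmod z"
    using cos_int by (simp add: g_def prob_space)
  \<comment> \<open>The sum of the two cosines is 2 cos(a + s/2) cos(s/2). Since |s| \<le> pi makes
    cos(s/2) nonnegative, the worst case is cos(a + s/2) = 1.\<close>
  have "2 * (1 - cos (s / 2)) \<le> g (lattice_pt v D k) + g (lattice_pt v D (k + 1))" for k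
  proof -
    define a where "a = s / D * lattice_pt v D k - \<alpha>"
    have "s / D * lattice_pt v D (k + 1) - \<alpha> = a + s"
      using D by (simp add: a_def lattice_pt_def field_simps)
    then have "g (lattice_pt v D k) + g (lattice_pt v D (k + 1)) = 2 - (cos (a + s) + cos a)"
      by (simp only: g_def a_def)
    also have "cos (a + s) + cos a = 2 * cos (a + s / 2) * cos (s / 2)"
      using cos_plus_cos[of "a + s" a] by (simp add: field_simps)
    finally have *: "g (lattice_pt v D k) + g (lattice_pt v D (k + 1)) = 2 - 2 * cos (a + s / 2) * cos (s / 2)" .
    have "0 \<le> cos (s / 2)" using s by (intro cos_ge_zero) auto
    then have "cos (a + s / 2) * cos (s / 2) \<le> 1 * cos (s / 2)"
      by (intro mult_right_mono) auto
    then show ?thesis using * by simp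
  qed
  moreover have "integrable M (\<lambda>\<omega>. g (Y \<omega>))"
    using cos_int by (simp add: g_def)
  ultimately have "2 * (1 - cos (s / 2)) * vartheta M v D Y \<le> 2 * (1 - cmod z)"
    unfolding cz[symmetric] using D by (intro vartheta_le_expectation) (auto simp: g_def)
  moreover have "2 * (1 - cos (s / 2)) * \<theta> \<le> 2 * (1 - cos (s / 2)) * vartheta M v D Y"
    using \<theta> by (intro mult_left_mono) auto
  \<comment> \<open>Here \<theta> may have either sign: \<open>max \<theta> 0\<close> keeps the
    multiplication monotone, and for \<theta> \<le> 0 the claim follows from \<open>cmod z\<close>
    \<le> 1.\<close>
  moreover have "s\<^sup>2 / 16 * max \<theta> 0 \<le> (1 - cos (s / 2)) * max \<theta> 0"
    using cos_half_le[OF s] by (intro mult_right_mono) auto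
  ultimately have "cmod z \<le> 1 - \<theta> * s\<^sup>2 / 16" if "0 \<le> \<theta>"
    using that by (simp add: max_def algebra_simps split: if_splits)
  moreover have "cmod z \<le> 1"
    unfolding z_def by (intro real_distribution.cmod_char_le_1 real_distribution_distr) auto
  moreover have "1 \<le> exp (- (\<theta> * s\<^sup>2 / 16))" if "\<theta> \<le> 0"
    using that by (simp add: mult_nonpos_nonneg)
  ultimately show ?thesis
    using exp_ge_add_one_self[of "- (\<theta> * s\<^sup>2 / 16)"] unfolding z_def by linarith
qed

section \<open>Sums of independent random variables\<close>

lemma (in prob_space) indep_var_sum_sum:
  fixes X :: "'i \<Rightarrow> 'a \<Rightarrow> real"
  assumes "indep_vars (\<lambda>_. borel) X I" "A \<inter> B = {}" "A \<subseteq> I" "B \<subseteq> I"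
  shows "indep_var borel (\<lambda>\<omega>. \<Sum>i\<in>A. X i \<omega>) borel (\<lambda>\<omega>. \<Sum>i\<in>B. X i \<omega>)"
proof -
  have "indep_var
    borel ((\<lambda>f. \<Sum>i\<in>A. f i) \<circ> (\<lambda>\<omega>. restrict (\<lambda>i. X i \<omega>) A))
    borel ((\<lambda>f. \<Sum>i\<in>B. f i) \<circ> (\<lambda>\<omega>. restrict (\<lambda>i. X i \<omega>) B))"
    by (intro indep_var_compose[OF indep_var_restrict[OF assms]] borel_measurable_sum) auto
  also have "((\<lambda>f. \<Sum>i\<in>A. f i) \<circ> (\<lambda>\<omega>. restrict (\<lambda>i. X i \<omega>) A)) = (\<lambda>\<omega>. \<Sum>i\<in>A. X i \<omega>)"
    by (auto cong: rev_conj_cong)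
  also have "((\<lambda>f. \<Sum>i\<in>B. f i) \<circ> (\<lambda>\<omega>. restrict (\<lambda>i. X i \<omega>) B)) = (\<lambda>\<omega>. \<Sum>i\<in>B. X i \<omega>)"
    by (auto cong: rev_conj_cong)
  finally show ?thesis .
qed

lemma (in prob_space)
  fixes A B :: "'a \<Rightarrow> real"
  assumes ind: "indep_var borel A borel B"
    and A: "integrable M (\<lambda>\<omega>. (A \<omega>)\<^sup>2)" and B: "integrable M (\<lambda>\<omega>. (B \<omega>)\<^sup>2)"
  shows integrable_indep_add_square: "integrable M (\<lambda>\<omega>. (A \<omega> + B \<omega>)\<^sup>2)"
    and variance_indep_add: "variance (\<lambda>\<omega>. A \<omega> + B \<omega>) = variance A + variance B"
proof -
  note [measurable] = indep_var_rv1[OF ind] indep_var_rv2[OF ind]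
  have A1: "integrable M A" by (rule square_integrable_imp_integrable[OF _ A]) measurable
  have B1: "integrable M B" by (rule square_integrable_imp_integrable[OF _ B]) measurable
  note AB = indep_var_integrable[OF ind A1 B1] indep_var_lebesgue_integral[OF ind A1 B1]
  show int: "integrable M (\<lambda>\<omega>. (A \<omega> + B \<omega>)\<^sup>2)"
    using A B AB by (simp add: power2_sum mult.assoc)
  have "expectation (\<lambda>\<omega>. (A \<omega> + B \<omega>)\<^sup>2) =
      expectation (\<lambda>\<omega>. (A \<omega>)\<^sup>2) + expectation (\<lambda>\<omega>. (B \<omega>)\<^sup>2) + 2 * (expectation A * expectation B)"
    using A B AB by (simp add: power2_sum mult.assoc)
  then show "variance (\<lambda>\<omega>. A \<omega> + B \<omega>) = variance A + variance B"
    using variance_eq[OF Bochner_Integration.integrable_add[OF A1 B1] int]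
      variance_eq[OF A1 A] variance_eq[OF B1 B] A1 B1
    by (simp add: power2_sum)
qed

lemma (in prob_space)
  fixes X :: "'i \<Rightarrow> 'a \<Rightarrow> real"
  assumes "finite A" "indep_vars (\<lambda>_. borel) X A" "\<And>i. i \<in> A \<Longrightarrow> integrable M (\<lambda>\<omega>. (X i \<omega>)\<^sup>2)"
  shows integrable_indep_sum_square: "integrable M (\<lambda>\<omega>. (\<Sum>i\<in>A. X i \<omega>)\<^sup>2)"
    and variance_indep_sum: "variance (\<lambda>\<omega>. \<Sum>i\<in>A. X i \<omega>) = (\<Sum>i\<in>A. variance (X i))"
proof -
  \<comment> \<open>One induction carries both facts, because adding variances at each step requires
    the partial sum to be square integrable.\<close>
  have "integrable M (\<lambda>\<omega>. (\<Sum>i\<in>A. X i \<omega>)\<^sup>2) \<and> variance (\<lambda>\<omega>. \<Sum>i\<in>A. X i \<omega>) = (\<Sum>i\<in>A. variance (X i))"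
    using assms
  proof (induction A rule: finite_induct)
    case (insert i A)
    have IH: "integrable M (\<lambda>\<omega>. (\<Sum>i\<in>A. X i \<omega>)\<^sup>2)"
      "variance (\<lambda>\<omega>. \<Sum>i\<in>A. X i \<omega>) = (\<Sum>i\<in>A. variance (X i))"
      using insert indep_vars_subset[OF insert.prems(1), of A] by auto
    note ind = indep_vars_sum[OF insert.hyps insert.prems(1)]
    show ?case
      using integrable_indep_add_square[OF ind insert.prems(2) IH(1)]
        variance_indep_add[OF ind insert.prems(2) IH(1)] IH(2) insert.hyps by simp
  qed simp
  then show "integrable M (\<lambda>\<omega>. (\<Sum>i\<in>A. X i \<omega>)\<^sup>2)"
    "variance (\<lambda>\<omega>. \<Sum>i\<in>A. X i \<omega>) = (\<Sum>i\<in>A. variance (X i))" by auto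
qed

section \<open>First absolute moments: of a random variable and of a truncated Gaussian
  kernel\<close>

lemma (in prob_space) expectation_abs_le_sqrt:
  fixes A :: "'a \<Rightarrow> real"
  assumes A: "A \<in> borel_measurable M" and sq: "integrable M (\<lambda>\<omega>. (A \<omega>)\<^sup>2)"
  shows "expectation (\<lambda>\<omega>. \<bar>A \<omega>\<bar>) \<le> sqrt (expectation (\<lambda>\<omega>. (A \<omega>)\<^sup>2))"
proof -
  have "integrable M A" using square_integrable_imp_integrable[OF A sq] .
  then have "0 \<le> expectation (\<lambda>\<omega>. (A \<omega>)\<^sup>2) - (expectation (\<lambda>\<omega>. \<bar>A \<omega>\<bar>))\<^sup>2"
    using variance_positive[of "\<lambda>\<omega>. \<bar>A \<omega>\<bar>"] variance_eq[of "\<lambda>\<omega>. \<bar>A \<omega>\<bar>"] sq by simp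
  then show ?thesis by (intro real_le_rsqrt) simp
qed

text \<open>The weight |s| gives the kernel an elementary antiderivative, so the integral is exactly
  (1 - exp(-c pi^2)) / c. The weight will come from |1 - phi_W(s)| \<le> |s| E|W|.\<close>

lemma
  fixes c :: real
  assumes c: "c > 0"
  shows integrable_abs_gaussian: "integrable lborel (\<lambda>s. indicator {-pi..pi} s * (\<bar>s\<bar> * exp (- (c * s\<^sup>2))))"
    and integral_abs_gaussian_le: "(\<integral>s. indicator {-pi..pi} s * (\<bar>s\<bar> * exp (- (c * s\<^sup>2))) \<partial>lborel) \<le> 1 / c"
proof -
  let ?f = "\<lambda>s. \<bar>s\<bar> * exp (- (c * s\<^sup>2))"
  show "integrable lborel (\<lambda>s. indicator {-pi..pi} s * ?f s)"
    using borel_integrable_compact[of "{-pi..pi}" ?f] by (simp add: continuous_intros)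
  then have "((\<lambda>s. indicator {-pi..pi} s * ?f s) has_integral
      (\<integral>s. indicator {-pi..pi} s * ?f s \<partial>lborel)) UNIV"
    by (rule has_integral_integral_lborel)
  then have 1: "(?f has_integral (\<integral>s. indicator {-pi..pi} s * ?f s \<partial>lborel)) {-pi..pi}"
    by (subst has_integral_restrict_UNIV[symmetric])
      (auto simp: indicator_def if_distrib cong: if_cong elim!: has_integral_eq[rotated])
  \<comment> \<open>An antiderivative of s exp(-c s^2), normalised to vanish at 0. On the left half
    |s| = -s, so its increment enters with the opposite sign.\<close>
  let ?F = "\<lambda>s. (1 - exp (- (c * s\<^sup>2))) / (2 * c)"
  have F: "(?F has_vector_derivative s * exp (- (c * s\<^sup>2))) (at s within U)" for s :: real and U
    unfolding has_real_derivative_iff_has_vector_derivative[symmetric] using c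
    by (auto intro!: derivative_eq_intros simp: field_simps)
  have "((\<lambda>s. s * exp (- (c * s\<^sup>2))) has_integral (?F pi - ?F 0)) {0..pi}"
    by (intro fundamental_theorem_of_calculus F) auto
  then have r: "(?f has_integral (?F pi - ?F 0)) {0..pi}"
    by (rule has_integral_eq[rotated]) auto
  have "((\<lambda>s. s * exp (- (c * s\<^sup>2))) has_integral (?F 0 - ?F (-pi))) {-pi..0}"
    by (intro fundamental_theorem_of_calculus F) auto
  then have "((\<lambda>s. - (s * exp (- (c * s\<^sup>2)))) has_integral - (?F 0 - ?F (-pi))) {-pi..0}"
    by (rule has_integral_neg)
  then have l: "(?f has_integral - (?F 0 - ?F (-pi))) {-pi..0}"
    by (rule has_integral_eq[rotated]) auto
  have "(?f has_integral (- (?F 0 - ?F (-pi)) + (?F pi - ?F 0))) {-pi..pi}"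
    by (rule has_integral_combine[OF _ _ l r]) auto
  then have "(\<integral>s. indicator {-pi..pi} s * ?f s \<partial>lborel) = - (?F 0 - ?F (-pi)) + (?F pi - ?F 0)"
    using 1 by (rule has_integral_unique[rotated])
  also have "\<dots> = (1 - exp (- (c * pi\<^sup>2))) / c"
    using c by (simp add: field_simps)
  also have "\<dots> \<le> 1 / c"
    using c by (intro divide_right_mono) auto
  finally show "(\<integral>s. indicator {-pi..pi} s * ?f s \<partial>lborel) \<le> 1 / c" .
qed

section \<open>Fourier inversion for integer-valued random variables\<close>

text \<open>Orthogonality of the integer-frequency exponentials over one full period.\<close>

lemma integral_iexp_Ints:
  assumes z: "z \<in> \<int>"
  shows "(CLBINT s. indicator {-pi..pi} s *\<^sub>R iexp (s * z)) = (if z = 0 then 2 * pi else 0)"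
proof (cases "z = 0")
  case False
  obtain k where k: "z = real_of_int k"
    using z by (auto elim: Ints_cases)
  define F where "F s = - (\<i> / z) * exp (\<i> * (complex_of_real s * z))" for s
  have "(CLBINT s. indicator {-pi..pi} s *\<^sub>R iexp (s * z)) = F pi - F (- pi)"
  proof (rule integral_FTC_atLeastAtMost)
    show "(F has_vector_derivative iexp (s * z)) (at s within {-pi..pi})" for s
      unfolding F_def using False
      by (intro has_vector_derivative_real_field) (auto intro!: derivative_eq_intros simp: field_simps)
  qed (auto intro!: continuous_intros)
  \<comment> \<open>The two values have equal real parts because cos is even, and equal imaginary
    parts because sin(pi z) = 0 for integer z.\<close>
  also have "iexp (pi * z) = iexp (- pi * z)"
    using sin_times_pi_eq_0[of z] z
    by (simp add: complex_eq_iff Re_exp Im_exp mult.commute)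
  then have "F pi - F (- pi) = 0"
    by (simp add: F_def)
  finally show ?thesis using False by simp
qed (simp add: scaleR_conv_of_real)

text \<open>Orthogonality, applied at almost every \<omega>, turns the integral of exp(i s Z) over s
  into 2 pi times the indicator of Z = 0; Fubini then exchanges this integral with the
  expectation.\<close>

lemma (in prob_space) prob_zero_inversion:
  fixes Z :: "'a \<Rightarrow> real"
  assumes Z[measurable]: "Z \<in> borel_measurable M" and int: "AE \<omega> in M. Z \<omega> \<in> \<int>"
  shows "complex_of_real (prob {\<omega> \<in> space M. Z \<omega> = 0})
    = (CLBINT s. indicator {-pi..pi} s *\<^sub>R char (distr M borel Z) s) / (2 * pi)"
proof -
  interpret P: pair_sigma_finite lborel M ..
  let ?f = "\<lambda>s \<omega>. indicat_real {-pi..pi} s *\<^sub>R iexp (s * Z \<omega>)"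
  have "(CLBINT s. indicator {-pi..pi} s *\<^sub>R char (distr M borel Z) s)
      = (CLBINT s. (CLINT \<omega>|M. ?f s \<omega>))"
    by (simp add: char_def integral_distr)
  also have "\<dots> = (CLINT \<omega>|M. (CLBINT s. ?f s \<omega>))"
  \<comment> \<open>Fubini applies because the integrand is bounded by 1 and supported on a set of
    finite product measure.\<close>
  proof (intro P.Fubini_integral[symmetric] integrableI_bounded_set[where B = 1 and A = "{-pi..pi} \<times> space M"])
    show "emeasure (lborel \<Otimes>\<^sub>M M) ({-pi..pi} \<times> space M) < \<infinity>"
      by (subst emeasure_pair_measure_Times) (auto simp: ennreal_mult_less_top emeasure_space_1)
  qed (auto intro!: AE_I2 simp: space_pair_measure indicator_def)
  also have "\<dots> = (CLINT \<omega>|M. complex_of_real (2 * pi * indicat_real {\<omega> \<in> space M. Z \<omega> = 0} \<omega>))"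
  proof (rule integral_cong_AE)
    show "AE \<omega> in M. (CLBINT s. ?f s \<omega>) = complex_of_real (2 * pi * indicat_real {\<omega> \<in> space M. Z \<omega> = 0} \<omega>)"
      using int AE_space by eventually_elim (subst integral_iexp_Ints, auto)
  qed measurable
  also have "\<dots> = complex_of_real (2 * pi * prob {\<omega> \<in> space M. Z \<omega> = 0})"
    unfolding integral_of_real by simp
  finally show ?thesis by simp
qed

text \<open>Independence factors the characteristic function of W + Z, so the two inversion
  integrals differ by that of (1 - phi_W) phi_Z. The factor 1/(2 pi) comes from inversion and 1/c
  from the truncated Gaussian moment.\<close>

lemma (in prob_space) prob_zero_indep_add_diff:
  fixes W Z :: "'a \<Rightarrow> real"
  assumes ind: "indep_var borel W borel Z" and W: "integrable M W"
    and Z_int: "AE \<omega> in M. Z \<omega> \<in> \<int>" and WZ_int: "AE \<omega> in M. W \<omega> + Z \<omega> \<in> \<int>"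
    and c: "c > 0" and char_le: "\<And>s. \<bar>s\<bar> \<le> pi \<Longrightarrow> cmod (char (distr M borel Z) s) \<le> exp (- (c * s\<^sup>2))"
  shows "\<bar>prob {\<omega> \<in> space M. Z \<omega> = 0} - prob {\<omega> \<in> space M. W \<omega> + Z \<omega> = 0}\<bar>
    \<le> expectation (\<lambda>\<omega>. \<bar>W \<omega>\<bar>) / (2 * pi * c)"
proof -
  note [measurable] = indep_var_rv1[OF ind] indep_var_rv2[OF ind]
  define w where "w = char (distr M borel W)"
  define z where "z = char (distr M borel Z)"
  let ?I = "\<lambda>s. indicat_real {-pi..pi} s"
  have [measurable]: "w \<in> borel_measurable borel" "z \<in> borel_measurable borel"
    by (auto simp: w_def z_def intro!: real_distribution.char_measurable real_distribution_distr)
  have le1: "cmod (w s) \<le> 1" "cmod (z s) \<le> 1" for s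
    by (auto simp: w_def z_def intro!: real_distribution.cmod_char_le_1 real_distribution_distr)
  have le1': "cmod (w s * z s) \<le> 1" for s
    unfolding norm_mult by (intro mult_le_one le1) auto
  have intz: "complex_integrable lborel (\<lambda>s. ?I s *\<^sub>R z s)"
    "complex_integrable lborel (\<lambda>s. ?I s *\<^sub>R (w s * z s))"
    by (auto intro!: integrableI_bounded_set_indicator[where B = 1] AE_I2 le1 le1')
  \<comment> \<open>Zeroth-order Taylor estimate |exp(i x) - 1| \<le> |x|, integrated at x = s
    W.\<close>
  have w1: "cmod (1 - w s) \<le> \<bar>s\<bar> * expectation (\<lambda>\<omega>. \<bar>W \<omega>\<bar>)" for s
  proof -
    have i: "complex_integrable M (\<lambda>\<omega>. iexp (s * W \<omega>))"
      by (rule integrable_iexp) auto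
    have "1 - w s = (CLINT \<omega>|M. 1 - iexp (s * W \<omega>))"
      using i by (simp add: w_def char_def integral_distr prob_space)
    also have "cmod \<dots> \<le> expectation (\<lambda>\<omega>. cmod (1 - iexp (s * W \<omega>)))"
      by (rule integral_norm_bound)
    also have "\<dots> \<le> expectation (\<lambda>\<omega>. \<bar>s\<bar> * \<bar>W \<omega>\<bar>)"
      using i W iexp_approx1[of "s * W \<omega>" 0 for \<omega>]
      by (intro integral_mono) (auto simp: abs_mult norm_minus_commute)
    finally show ?thesis by simp
  qed
  have bound: "cmod (?I s *\<^sub>R ((1 - w s) * z s))
      \<le> expectation (\<lambda>\<omega>. \<bar>W \<omega>\<bar>) * (?I s * (\<bar>s\<bar> * exp (- (c * s\<^sup>2))))" for s
  proof (cases "s \<in> {-pi..pi}")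
    case True
    then have "cmod (1 - w s) * cmod (z s) \<le> (\<bar>s\<bar> * expectation (\<lambda>\<omega>. \<bar>W \<omega>\<bar>)) * exp (- (c * s\<^sup>2))"
      by (intro mult_mono w1) (auto simp: z_def intro!: char_le integral_nonneg)
    then show ?thesis using True by (simp add: norm_mult mult_ac)
  qed simp
  have "complex_of_real (prob {\<omega> \<in> space M. Z \<omega> = 0} - prob {\<omega> \<in> space M. W \<omega> + Z \<omega> = 0})
      = ((CLBINT s. ?I s *\<^sub>R z s) - (CLBINT s. ?I s *\<^sub>R (w s * z s))) / (2 * pi)"
    using prob_zero_inversion[OF _ Z_int] prob_zero_inversion[OF _ WZ_int]
    by (simp add: char_distr_add[OF ind] w_def z_def diff_divide_distrib)
  also have "(CLBINT s. ?I s *\<^sub>R z s) - (CLBINT s. ?I s *\<^sub>R (w s * z s))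
      = (CLBINT s. ?I s *\<^sub>R ((1 - w s) * z s))"
    using intz by (simp add: algebra_simps)
  finally have eq: "complex_of_real (prob {\<omega> \<in> space M. Z \<omega> = 0} - prob {\<omega> \<in> space M. W \<omega> + Z \<omega> = 0})
      = (CLBINT s. ?I s *\<^sub>R ((1 - w s) * z s)) / (2 * pi)" .
  have "\<bar>prob {\<omega> \<in> space M. Z \<omega> = 0} - prob {\<omega> \<in> space M. W \<omega> + Z \<omega> = 0}\<bar>
      = cmod ((CLBINT s. ?I s *\<^sub>R ((1 - w s) * z s)) / (2 * pi))"
    unfolding eq[symmetric] norm_of_real ..
  also have "\<dots> = cmod (CLBINT s. ?I s *\<^sub>R ((1 - w s) * z s)) / (2 * pi)"
    by (simp add: norm_divide norm_mult)
  also have "cmod (CLBINT s. ?I s *\<^sub>R ((1 - w s) * z s))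
      \<le> (LBINT s. expectation (\<lambda>\<omega>. \<bar>W \<omega>\<bar>) * (?I s * (\<bar>s\<bar> * exp (- (c * s\<^sup>2)))))"
  proof (rule Bochner_Integration.integral_norm_bound_integral)
    show "complex_integrable lborel (\<lambda>s. ?I s *\<^sub>R ((1 - w s) * z s))"
      using Bochner_Integration.integrable_diff[OF intz] by (simp add: algebra_simps)
  qed (use bound integrable_abs_gaussian[OF c] in \<open>simp_all del: norm_scaleR\<close>)
  also have "\<dots> = expectation (\<lambda>\<omega>. \<bar>W \<omega>\<bar>) * (LBINT s. ?I s * (\<bar>s\<bar> * exp (- (c * s\<^sup>2))))"
    by simp
  also have "\<dots> \<le> expectation (\<lambda>\<omega>. \<bar>W \<omega>\<bar>) * (1 / c)"
    by (intro mult_left_mono integral_abs_gaussian_le[OF c]) auto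
  finally show ?thesis
    by (simp add: mult_ac divide_right_mono)
qed

section \<open>Sums of lattice-valued random variables\<close>

lemma sum_in_lattice_set:
  assumes "finite A" "\<And>j. j \<in> A \<Longrightarrow> f j \<in> lattice_set v D"
  shows "sum f A \<in> lattice_set (real (card A) * v) D"
  using assms
proof (induction A rule: finite_induct)
  case empty
  show ?case by (auto simp: lattice_set_def lattice_pt_def intro!: image_eqI[where x = 0])
next
  case (insert j A)
  then obtain k l where "sum f A = real (card A) * v + D * of_int k" "f j = v + D * of_int l"
    by (force simp: lattice_set_def lattice_pt_def)
  then show ?case
    using insert.hyps unfolding lattice_set_def lattice_pt_def
    by (intro range_eqI[where x = "k + l"]) (simp add: algebra_simps)
qed

lemma diff_in_lattice_set:
  assumes "x \<in> lattice_set u D" "y \<in> lattice_set v D"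
  shows "x - y \<in> lattice_set (u - v) D"
proof -
  obtain k l where "x = u + D * of_int k" "y = v + D * of_int l"
    using assms by (auto simp: lattice_set_def lattice_pt_def)
  then show ?thesis
    unfolding lattice_set_def lattice_pt_def
    by (intro range_eqI[where x = "k - l"]) (simp add: algebra_simps)
qed

lemma lattice_set_diff_divide_Ints:
  assumes "D > 0" "x \<in> lattice_set v D" "y \<in> lattice_set v D"
  shows "(x - y) / D \<in> \<int>"
proof -
  obtain k l where "x = v + D * of_int k" "y = v + D * of_int l"
    using assms by (auto simp: lattice_set_def lattice_pt_def)
  then have "(x - y) / D = of_int (k - l)"
    using assms by (simp add: field_simps)
  then show ?thesis by (simp only: Ints_of_int)
qed

text \<open>Centring the block sums at \<open>a\<close> and \<open>b\<close> and dividing by D gives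
  integer-valued W and Z; the two events become Z = 0 and W + Z = 0. With decay rate c =
  \<open>sum \<theta> B / 16\<close>, the factor 1/(2 pi c) and the 1/D from rescaling W yield 8/(pi
  D).\<close>

lemma (in prob_space) prob_sum_shift_diff:
  fixes X :: "'i \<Rightarrow> 'a \<Rightarrow> real"
  assumes D: "D > 0" and A: "finite A" and B: "finite B" and AB: "A \<inter> B = {}"
    and ind: "indep_vars (\<lambda>_. borel) X (A \<union> B)"
    and sq: "\<And>j. j \<in> A \<Longrightarrow> integrable M (\<lambda>\<omega>. (X j \<omega>)\<^sup>2)"
    and lat: "\<And>j. j \<in> A \<union> B \<Longrightarrow> AE \<omega> in M. X j \<omega> \<in> lattice_set v D"
    and a: "a \<in> lattice_set (real (card A) * v) D" and b: "b \<in> lattice_set (real (card B) * v) D"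
    and \<theta>: "\<And>j. j \<in> B \<Longrightarrow> \<theta> j \<le> vartheta M v D (X j)" and pos: "0 < sum \<theta> B"
  shows "\<bar>prob {\<omega> \<in> space M. (\<Sum>j\<in>B. X j \<omega>) = b}
      - prob {\<omega> \<in> space M. (\<Sum>j\<in>A. X j \<omega>) + (\<Sum>j\<in>B. X j \<omega>) = a + b}\<bar>
    \<le> 8 / (pi * D) * expectation (\<lambda>\<omega>. \<bar>(\<Sum>j\<in>A. X j \<omega>) - a\<bar>) / sum \<theta> B"
proof -
  have X[measurable]: "X j \<in> borel_measurable M" if "j \<in> A \<union> B" for j
    using ind that by (auto simp: indep_vars_def)
  define W where "W \<omega> = ((\<Sum>j\<in>A. X j \<omega>) - a) / D" for \<omega>
  define Z where "Z \<omega> = ((\<Sum>j\<in>B. X j \<omega>) - b) / D" for \<omega>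
  have WZ: "indep_var borel W borel Z"
  proof -
    have "indep_var borel ((\<lambda>x. (x - a) / D) \<circ> (\<lambda>\<omega>. \<Sum>j\<in>A. X j \<omega>))
        borel ((\<lambda>x. (x - b) / D) \<circ> (\<lambda>\<omega>. \<Sum>j\<in>B. X j \<omega>))"
      by (rule indep_var_compose[OF indep_var_sum_sum[OF ind AB]]) auto
    then show ?thesis by (simp add: W_def[abs_def] Z_def[abs_def] comp_def)
  qed
  have lat_AB: "AE \<omega> in M. \<forall>j\<in>A \<union> B. X j \<omega> \<in> lattice_set v D"
    using A B lat by (intro AE_finite_allI) auto
  have Ints: "AE \<omega> in M. W \<omega> \<in> \<int> \<and> Z \<omega> \<in> \<int>"
    using lat_AB
  proof eventually_elim
    case (elim \<omega>)
    then show ?case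
      unfolding W_def Z_def
      using lattice_set_diff_divide_Ints[OF D sum_in_lattice_set[OF A] a]
        lattice_set_diff_divide_Ints[OF D sum_in_lattice_set[OF B] b] by auto
  qed
  \<comment> \<open>The shift by \<open>b\<close> contributes a factor of modulus one, independence
    factors the rest, and the decay rates of the summands add up.\<close>
  have char_le: "cmod (char (distr M borel Z) s) \<le> exp (- (sum \<theta> B / 16 * s\<^sup>2))" if s: "\<bar>s\<bar> \<le> pi" for s
  proof -
    have "char (distr M borel Z) s = (CLINT \<omega>|M. iexp (s / D * (\<Sum>j\<in>B. X j \<omega>)) * iexp (- (s / D * b)))"
      using X by (simp add: char_def integral_distr Z_def[abs_def] exp_add[symmetric] algebra_simps
          diff_divide_distrib)
    also have "\<dots> = char (distr M borel (\<lambda>\<omega>. \<Sum>j\<in>B. X j \<omega>)) (s / D) * iexp (- (s / D * b))"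
      by (simp add: char_def integral_distr)
    finally have "cmod (char (distr M borel Z) s) = (\<Prod>j\<in>B. cmod (char (distr M borel (X j)) (s / D)))"
      using char_distr_sum[OF indep_vars_subset[OF ind, of B], of "s / D"]
      by (simp only: norm_mult norm_exp_i_times prod_norm) simp
    also have "\<dots> \<le> (\<Prod>j\<in>B. exp (- (\<theta> j * s\<^sup>2 / 16)))"
      using \<theta> s by (intro prod_mono conjI char_le_vartheta[OF D]) auto
    also have "\<dots> = exp (- (sum \<theta> B / 16 * s\<^sup>2))"
      using B by (simp add: exp_sum[symmetric] sum_negf sum_distrib_right sum_divide_distrib)
    finally show ?thesis .
  qed
  have "integrable M (\<lambda>\<omega>. \<Sum>j\<in>A. X j \<omega>)"
  proof (rule Bochner_Integration.integrable_sum)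
    show "integrable M (X j)" if "j \<in> A" for j
      by (rule square_integrable_imp_integrable[OF X sq]) (use that in auto)
  qed
  then have W: "integrable M W" by (simp add: W_def[abs_def])
  have "\<bar>prob {\<omega> \<in> space M. Z \<omega> = 0} - prob {\<omega> \<in> space M. W \<omega> + Z \<omega> = 0}\<bar>
      \<le> expectation (\<lambda>\<omega>. \<bar>W \<omega>\<bar>) / (2 * pi * (sum \<theta> B / 16))"
    by (rule prob_zero_indep_add_diff[OF WZ W]) (use Ints pos char_le in auto)
  also have "expectation (\<lambda>\<omega>. \<bar>W \<omega>\<bar>) = expectation (\<lambda>\<omega>. \<bar>(\<Sum>j\<in>A. X j \<omega>) - a\<bar>) / D"
    using D by (simp add: W_def)
  finally show ?thesis
    using D by (simp add: W_def Z_def add_divide_distrib[symmetric] algebra_simps)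
qed

section \<open>Correlation of the events S_n = kappa_n and S_m = kappa_m\<close>

theorem theorem2p1:
  fixes M :: "'a measure"
    and X :: "nat \<Rightarrow> 'a \<Rightarrow> real"
    and v0 D :: real
    and \<theta> \<kappa> :: "nat \<Rightarrow> real"
  assumes prob: "prob_space M"
    and D_pos: "D > 0"
    and indep: "prob_space.indep_vars M (\<lambda>_. borel) X {1..}"
    and square_int: "\<And>j. j \<ge> 1 \<Longrightarrow> integrable M (\<lambda>\<omega>. (X j \<omega>)\<^sup>2)"
    and lattice_valued: "\<And>j. j \<ge> 1 \<Longrightarrow> AE \<omega> in M. X j \<omega> \<in> lattice_set v0 D"
    and var_lim: "filterlim (\<lambda>n. prob_space.variance M (S X n)) at_top sequentially"
    and vartheta_pos: "\<And>j. j \<ge> 1 \<Longrightarrow> vartheta M v0 D (X j) > 0"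
    and theta_pos: "\<And>j. j \<ge> 1 \<Longrightarrow> 0 < \<theta> j"
    and theta_le: "\<And>j. j \<ge> 1 \<Longrightarrow> \<theta> j \<le> vartheta M v0 D (X j)"
    and nu_lim: "filterlim (nu \<theta>) at_top sequentially"
    and kappa_0: "\<kappa> 0 = 0"
    and kappa_lattice: "\<And>j. j \<ge> 1 \<Longrightarrow> \<kappa> j \<in> lattice_set (real j * v0) D"
    and cond1: "(\<lambda>j. (\<kappa> j - mean_S M X j) / sd_S M X j) \<in> O(\<lambda>_. 1)"
    and cond2: "\<exists>B. \<forall>i j. i \<le> j \<longrightarrow>
        \<bar>sqrt ((sd_S M X j)\<^sup>2 - (sd_S M X i)\<^sup>2) * \<P>(\<omega> in M. S X j \<omega> - S X i \<omega> = \<kappa> j - \<kappa> i)\<bar> \<le> B"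
  shows "\<exists>C. \<forall>m n. 1 \<le> m \<and> m < n \<longrightarrow>
      sd_S M X n * sd_S M X m *
        \<bar>\<P>(\<omega> in M. S X n \<omega> = \<kappa> n \<and> S X m \<omega> = \<kappa> m)
          - \<P>(\<omega> in M. S X n \<omega> = \<kappa> n) * \<P>(\<omega> in M. S X m \<omega> = \<kappa> m)\<bar>
      \<le> C / D\<^sup>2 * (max (sd_S M X n / sqrt (nu \<theta> n)) (sd_S M X m / sqrt (nu \<theta> m))) ^ 3 *
          (sqrt (nu \<theta> n) * ((\<Prod>j=m+1..n. \<theta> j) + 1 / (nu \<theta> n - nu \<theta> m) powr (3/2))
            + 1 / (sqrt (nu \<theta> n / nu \<theta> m) - 1))"
proof -
  interpret prob_space M by (rule prob)
  let ?s = "sd_S M X" and ?\<nu> = "nu \<theta>"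
  have X[measurable]: "X j \<in> borel_measurable M" if "j \<ge> 1" for j
    using indep that by (auto simp: indep_vars_def)
  have S_eq: "S X n = (\<lambda>\<omega>. \<Sum>j\<in>{1..n}. X j \<omega>)" for n
    by (simp add: S_def[abs_def])
  have S_meas[measurable]: "S X n \<in> borel_measurable M" for n
    unfolding S_eq by measurable
  have S_sq: "integrable M (\<lambda>\<omega>. (S X n \<omega>)\<^sup>2)" for n
    unfolding S_eq using square_int
    by (intro integrable_indep_sum_square indep_vars_subset[OF indep]) auto
  have S_int: "integrable M (S X n)" for n
    by (rule square_integrable_imp_integrable[OF S_meas S_sq])
  have nu_pos: "0 < ?\<nu> n" if "1 \<le> n" for n
    unfolding nu_def using that theta_pos by (intro sum_pos) auto
  \<comment> \<open>Variances add, and each summand contributes at least D^2 theta_j / 4. The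
    resulting ratio bound sigma_n / sqrt(nu_n) \<ge> D/2 later pays for the third power of the
    maximum.\<close>
  have s_ge: "D / 2 * sqrt (?\<nu> n) \<le> ?s n" for n
  proof -
    have "D\<^sup>2 / 4 * ?\<nu> n \<le> (\<Sum>j\<in>{1..n}. variance (X j))"
      unfolding nu_def sum_distrib_left
    proof (rule sum_mono)
      fix j assume j: "j \<in> {1..n}"
      then have "D\<^sup>2 / 4 * \<theta> j \<le> D\<^sup>2 / 4 * vartheta M v0 D (X j)"
        using theta_le by (intro mult_left_mono) auto
      also have "\<dots> \<le> variance (X j)"
        using j X square_int by (intro variance_ge_vartheta[OF D_pos]) auto
      finally show "D\<^sup>2 / 4 * \<theta> j \<le> variance (X j)" .
    qed
    also have "\<dots> = variance (S X n)"
      unfolding S_eq using square_int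
      by (intro variance_indep_sum[symmetric] indep_vars_subset[OF indep]) auto
    finally have "sqrt (D\<^sup>2 / 4 * ?\<nu> n) \<le> ?s n"
      unfolding sd_S_def by (rule real_sqrt_le_mono)
    then show ?thesis
      using D_pos by (simp add: real_sqrt_mult real_sqrt_divide)
  qed
  have s_pos: "0 < ?s n" if "1 \<le> n" for n
    using nu_pos[OF that] D_pos by (intro less_le_trans[OF _ s_ge[of n]] mult_pos_pos) auto
  \<comment> \<open>The O(1) condition bounds a tail only; a sequence with bounded tail is bounded,
    which gives one \<open>K\<close> for all indices.\<close>
  obtain K where K: "0 < K" "\<And>j. \<bar>(\<kappa> j - mean_S M X j) / ?s j\<bar> \<le> K"
  proof -
    obtain c where "\<forall>\<^sub>F j in sequentially. norm ((\<kappa> j - mean_S M X j) / ?s j) \<le> c * norm (1 :: real)"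
      using cond1 by (elim landau_o.bigE)
    then have "Bseq (\<lambda>j. (\<kappa> j - mean_S M X j) / ?s j)"
      by (intro BfunI[where K = c]) simp
    then show ?thesis using that by (elim BseqE) auto
  qed
  \<comment> \<open>Centring at the mean costs at most sigma_m; moving the centre to kappa_m costs
    at most K sigma_m.\<close>
  have dev: "expectation (\<lambda>\<omega>. \<bar>S X m \<omega> - \<kappa> m\<bar>) \<le> (1 + K) * ?s m" if m: "1 \<le> m" for m
  proof -
    have "expectation (\<lambda>\<omega>. \<bar>S X m \<omega> - \<kappa> m\<bar>)
        \<le> expectation (\<lambda>\<omega>. \<bar>S X m \<omega> - mean_S M X m\<bar> + \<bar>\<kappa> m - mean_S M X m\<bar>)"
      using S_int by (intro integral_mono) auto
    also have "\<dots> = expectation (\<lambda>\<omega>. \<bar>S X m \<omega> - mean_S M X m\<bar>) + \<bar>\<kappa> m - mean_S M X m\<bar>"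
      using S_int by (simp add: prob_space)
    also have "expectation (\<lambda>\<omega>. \<bar>S X m \<omega> - mean_S M X m\<bar>) \<le> ?s m"
      unfolding sd_S_def mean_S_def
      by (rule expectation_abs_le_sqrt) (use S_sq S_int in \<open>auto simp: power2_diff\<close>)
    also have "\<bar>\<kappa> m - mean_S M X m\<bar> \<le> K * ?s m"
      using K(2)[of m] s_pos[OF m] by (simp add: abs_divide field_simps)
    finally show ?thesis by (simp add: algebra_simps)
  qed
  \<comment> \<open>This is the second condition at i = 0, where S_0, sigma_0 and kappa_0 all
    vanish.\<close>
  obtain B where B: "\<And>m. ?s m * prob {\<omega> \<in> space M. S X m \<omega> = \<kappa> m} \<le> B"
  proof -
    obtain B where B: "\<bar>sqrt ((?s j)\<^sup>2 - (?s i)\<^sup>2) * prob {\<omega> \<in> space M. S X j \<omega> - S X i \<omega> = \<kappa> j - \<kappa> i}\<bar> \<le> B"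
      if "i \<le> j" for i j
      using cond2 by blast
    have S0: "S X 0 \<omega> = 0" "?s 0 = 0" "0 \<le> ?s m" for \<omega> m
      by (simp_all add: S_eq sd_S_def)
    have "\<bar>?s m * prob {\<omega> \<in> space M. S X m \<omega> = \<kappa> m}\<bar> \<le> B" for m
      using B[of 0 m] kappa_0 S0 by simp
    then show ?thesis using that by (meson abs_le_D1)
  qed
  \<comment> \<open>The factor 8/(pi D) from \<open>prob_sum_shift_diff\<close> times the factor 1 +
    K from \<open>dev\<close>.\<close>
  define Q where "Q = 8 * (1 + K) / (pi * D)"
  have Q: "0 < Q" using K D_pos by (simp add: Q_def add_pos_pos)
  have B0: "0 \<le> B"
    using s_pos[of 1] by (intro order_trans[OF _ B[of 1]] mult_nonneg_nonneg) auto
  show ?thesis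
  \<comment> \<open>After division by D^2 the witness becomes B Q (2/D); the factor 2/D is the price
    of replacing R^2 by R^3 below.\<close>
  proof (intro exI[of _ "2 * B * Q * D"] allI impI, elim conjE)
    fix m n :: nat
    assume m: "1 \<le> m" and mn: "m < n"
    define T where "T \<omega> = (\<Sum>j\<in>{m+1..n}. X j \<omega>)" for \<omega>
    have un: "{1..n} = {1..m} \<union> {m+1..n}" "{1..m} \<inter> {m+1..n} = {}"
      using mn by auto
    have S_split: "S X n \<omega> = S X m \<omega> + T \<omega>" for \<omega>
      unfolding S_def T_def un(1) by (rule sum.union_disjoint) auto
    have nu_split: "?\<nu> n = ?\<nu> m + sum \<theta> {m+1..n}"
      unfolding nu_def un(1) by (rule sum.union_disjoint) auto
    have T_pos: "0 < sum \<theta> {m+1..n}"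
      using mn theta_pos by (intro sum_pos) auto
    have ind: "indep_vars (\<lambda>_. borel) X ({1..m} \<union> {m+1..n})"
      by (rule indep_vars_subset[OF indep]) auto
    define p where "p = prob {\<omega> \<in> space M. S X m \<omega> = \<kappa> m}"
    define q where "q = prob {\<omega> \<in> space M. T \<omega> = \<kappa> n - \<kappa> m}"
    define r where "r = prob {\<omega> \<in> space M. S X n \<omega> = \<kappa> n}"
    \<comment> \<open>On S_m = kappa_m the condition S_n = kappa_n says T = kappa_n - kappa_m, so
      the joint event is a rectangle for the independent pair (S_m, T).\<close>
    have "prob {\<omega> \<in> space M. S X n \<omega> = \<kappa> n \<and> S X m \<omega> = \<kappa> m}
        = prob ((\<lambda>\<omega>. (S X m \<omega>, T \<omega>)) -` ({\<kappa> m} \<times> {\<kappa> n - \<kappa> m}) \<inter> space M)"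
      by (intro arg_cong[where f = prob]) (auto simp: S_split)
    also have "\<dots> = prob (S X m -` {\<kappa> m} \<inter> space M) * prob (T -` {\<kappa> n - \<kappa> m} \<inter> space M)"
      using indep_var_sum_sum[OF ind un(2)]
      by (intro indep_varD[where Ma = borel and Mb = borel]) (auto simp: S_eq T_def[abs_def])
    also have "\<dots> = p * q"
      unfolding p_def q_def by (intro arg_cong2[where f = "(*)"] arg_cong[where f = prob]) auto
    finally have joint: "prob {\<omega> \<in> space M. S X n \<omega> = \<kappa> n \<and> S X m \<omega> = \<kappa> m} = p * q" .
    have "\<bar>q - r\<bar> \<le> 8 / (pi * D) * expectation (\<lambda>\<omega>. \<bar>S X m \<omega> - \<kappa> m\<bar>) / sum \<theta> {m+1..n}"
    proof -
      have "\<kappa> n - \<kappa> m \<in> lattice_set (real n * v0 - real m * v0) D"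
        using m mn by (intro diff_in_lattice_set kappa_lattice) auto
      also have "real n * v0 - real m * v0 = real (card {m+1..n}) * v0"
        using mn by (simp add: of_nat_diff algebra_simps)
      finally have "\<kappa> n - \<kappa> m \<in> lattice_set (real (card {m+1..n}) * v0) D" .
      moreover have "\<kappa> m \<in> lattice_set (real (card {1..m}) * v0) D"
        using kappa_lattice[OF m] by simp
      ultimately have "\<bar>prob {\<omega> \<in> space M. (\<Sum>j\<in>{m+1..n}. X j \<omega>) = \<kappa> n - \<kappa> m}
          - prob {\<omega> \<in> space M. (\<Sum>j\<in>{1..m}. X j \<omega>) + (\<Sum>j\<in>{m+1..n}. X j \<omega>) = \<kappa> m + (\<kappa> n - \<kappa> m)}\<bar>
        \<le> 8 / (pi * D) * expectation (\<lambda>\<omega>. \<bar>(\<Sum>j\<in>{1..m}. X j \<omega>) - \<kappa> m\<bar>) / sum \<theta> {m+1..n}"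
        using square_int lattice_valued theta_le T_pos
        by (intro prob_sum_shift_diff[OF D_pos _ _ un(2) ind]) auto
      then show ?thesis
        unfolding q_def r_def S_split by (simp add: S_def T_def)
    qed
    also have "\<dots> \<le> 8 / (pi * D) * ((1 + K) * ?s m) / sum \<theta> {m+1..n}"
      using T_pos D_pos by (intro divide_right_mono mult_left_mono dev[OF m]) auto
    also have "\<dots> = Q * ?s m / (?\<nu> n - ?\<nu> m)"
      by (simp add: Q_def nu_split)
    finally have qr: "\<bar>q - r\<bar> \<le> Q * ?s m / (?\<nu> n - ?\<nu> m)" .

    \<comment> \<open>Comparison with the claimed right-hand side\<close>
    define x where "x = sqrt (?\<nu> n)"
    define y where "y = sqrt (?\<nu> m)"
    define R where "R = max (?s n / x) (?s m / y)"
    have y: "0 < y" and yx: "y < x"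
      using nu_pos[OF m] nu_split T_pos by (simp_all add: x_def y_def)
    have nu_xy: "?\<nu> n = x\<^sup>2" "?\<nu> m = y\<^sup>2"
      using nu_pos[of m] nu_pos[of n] m mn by (simp_all add: x_def y_def)
    have sR: "?s n \<le> R * x" "?s m \<le> R * y"
      using y yx by (simp_all add: R_def pos_divide_le_eq[symmetric])
    have R: "D / 2 \<le> R"
      using s_ge[of n] y yx by (simp add: R_def le_max_iff_disj pos_le_divide_eq x_def[symmetric])
    define U where "U = 1 / (x / y - 1)"
    \<comment> \<open>Split the quotient as y/(x - y) times x/(x + y): the first factor equals
      \<open>U\<close>, the second is at most 1.\<close>
    have U: "x * y / (x\<^sup>2 - y\<^sup>2) \<le> U"
    proof -
      have "x * y / (x\<^sup>2 - y\<^sup>2) = y / (x - y) * (x / (x + y))"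
        by (simp add: square_diff_square_factored power2_eq_square mult_ac)
      also have "\<dots> \<le> y / (x - y) * 1"
        using y yx by (intro mult_left_mono) auto
      also have "\<dots> = U"
        using y yx by (simp add: U_def field_simps)
      finally show ?thesis .
    qed
    have R0: "0 \<le> R" using R D_pos by simp
    have U0: "0 \<le> U" using y yx by (simp add: U_def)
    have p0: "0 \<le> p" by (simp add: p_def)
    have xy: "0 < x\<^sup>2 - y\<^sup>2" using y yx by (simp add: power_strict_mono)
    have "?s n * ?s m * \<bar>p * q - r * p\<bar> = ?s n * (?s m * p) * \<bar>q - r\<bar>"
    proof -
      have "p * q - r * p = p * (q - r)" by (simp add: algebra_simps)
      then show ?thesis using p0 by (simp add: abs_mult)
    qed
    \<comment> \<open>The factor sigma_m is paired with p and bounded by \<open>B\<close>; a second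
      sigma_m reappears from the bound on |q - r|.\<close>
    also have "\<dots> \<le> ?s n * B * (Q * ?s m / (x\<^sup>2 - y\<^sup>2))"
      using qr B[of m] B0 s_pos[of m] s_pos[of n] m mn
      by (intro mult_mono) (auto simp: p_def nu_xy)
    also have "\<dots> = B * Q * (?s n * ?s m) / (x\<^sup>2 - y\<^sup>2)"
      by simp
    also have "\<dots> \<le> B * Q * ((R * x) * (R * y)) / (x\<^sup>2 - y\<^sup>2)"
      using B0 Q sR R0 y yx s_pos[of m] s_pos[of n] m mn xy
      by (intro divide_right_mono mult_left_mono mult_mono) auto
    also have "\<dots> = B * Q * R\<^sup>2 * (x * y / (x\<^sup>2 - y\<^sup>2))"
      by (simp add: power2_eq_square)
    also have "\<dots> \<le> B * Q * R\<^sup>2 * U"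
      using B0 Q by (intro mult_left_mono U) auto
    \<comment> \<open>Since R \<ge> D/2, one more factor R costs only 2/D.\<close>
    also have "\<dots> \<le> B * Q * (2 / D * R ^ 3) * U"
    proof -
      have "R\<^sup>2 * D \<le> R\<^sup>2 * (2 * R)"
        using R by (intro mult_left_mono) auto
      then have "R\<^sup>2 \<le> 2 / D * R ^ 3"
        using D_pos by (simp add: field_simps power2_eq_square power3_eq_cube)
      then show ?thesis
        using B0 Q U0 by (intro mult_left_mono mult_right_mono) auto
    qed
    also have "\<dots> = 2 * B * Q * D / D\<^sup>2 * R ^ 3 * U"
      using D_pos by (simp add: field_simps power2_eq_square)
    \<comment> \<open>The bound is complete with \<open>U\<close> alone; the remaining summand is
      nonnegative and may be added.\<close>
    also have "\<dots> \<le> 2 * B * Q * D / D\<^sup>2 * R ^ 3 *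
        (x * ((\<Prod>j=m+1..n. \<theta> j) + 1 / (?\<nu> n - ?\<nu> m) powr (3/2)) + U)"
    proof -
      have "0 \<le> x * ((\<Prod>j=m+1..n. \<theta> j) + 1 / (?\<nu> n - ?\<nu> m) powr (3/2))"
        using y yx theta_pos by (intro mult_nonneg_nonneg add_nonneg_nonneg prod_nonneg) (auto intro: less_imp_le)
      moreover have "0 \<le> 2 * B * Q * D / D\<^sup>2 * R ^ 3"
        using B0 Q D_pos R0 by (intro mult_nonneg_nonneg divide_nonneg_nonneg zero_le_power) auto
      ultimately show ?thesis by (intro mult_left_mono) auto
    qed
    finally have "?s n * ?s m * \<bar>p * q - r * p\<bar> \<le> 2 * B * Q * D / D\<^sup>2 * R ^ 3 *
        (x * ((\<Prod>j=m+1..n. \<theta> j) + 1 / (?\<nu> n - ?\<nu> m) powr (3/2)) + U)" .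
    then show "?s n * ?s m *
        \<bar>prob {\<omega> \<in> space M. S X n \<omega> = \<kappa> n \<and> S X m \<omega> = \<kappa> m}
          - prob {\<omega> \<in> space M. S X n \<omega> = \<kappa> n} * prob {\<omega> \<in> space M. S X m \<omega> = \<kappa> m}\<bar>
      \<le> 2 * B * Q * D / D\<^sup>2 * (max (?s n / sqrt (?\<nu> n)) (?s m / sqrt (?\<nu> m))) ^ 3 *
          (sqrt (?\<nu> n) * ((\<Prod>j=m+1..n. \<theta> j) + 1 / (?\<nu> n - ?\<nu> m) powr (3/2))
            + 1 / (sqrt (?\<nu> n / ?\<nu> m) - 1))"
      unfolding joint p_def[symmetric] r_def[symmetric] real_sqrt_divide
        x_def[symmetric] y_def[symmetric] R_def[symmetric] U_def[symmetric] .
  qed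
qed

end
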